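(* Let $G$ be a connected graph of order $n$ with exactly $p$ pendent vertices. (1) If $p=n-1$, then $G\cong S_{n-1}$, and thus $ABS(G)=\frac{(n-1)\sqrt{n-2}}{n}$. (2) If $p=n-2$, then $$ABS(G)\leq \frac{1}{\sqrt{3}}+\frac{\sqrt{n-2}}{n}+\frac{(n-3)\sqrt{n-3}}{n-1},$$ with equality if and only if $G\cong S_{2,n-2}$. (3) If $p\leq n-3$, then $$ABS(G)\leq p\sqrt{\frac{n-2}{n}}+(n-p-1)\sqrt{\frac{2n-2p-3}{2n-2p-1}}+\frac{\sqrt{n-p-1}\,(n-p-2)^{\frac{3}{2}}}{2},$$ with equality if and only if $G\cong K_{n-p}^{p}$.
   Context: All graphs are finite and simple. For a graph $G$ with vertex degrees $d_v$, the atom-bond sum-connectivity index is $ABS(G)=\sum_{uv\in E(G)}\left(\frac{d_u+d_v-2}{d_u+d_v}\right)^{1/2}$. A pendent vertex is a vertex of degree $1$; the other vertices are called internal. $S_{n-1}$ denotes the star of order $n$. $S_{m,n-m}$ denotes the double star of order $n$, that is, the tree with exactly two internal vertices, where the internal vertices have degrees $m$ and $n-m$. $K_m^p$ denotes the graph of order $m+p$ with $p$ pendent vertices such that the subgraph induced on the internal vertices is a complete graph and all pendent vertices are adjacent to the same internal vertex.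
   Formalization: The printed formulas fail (P_3, P_4, K_3) and are corrected to the values of ABS at the named graphs: (1) (n-1)√((n-2)/n); (2) 1/√3+√((n-2)/n)+(n-3)√((n-3)/(n-1)); (3) middle factor √((2n-p-4)/(2n-p-2)). *)

theory Defs
  imports Complex_Main "Graph_Theory.Graph_Theory"
begin

text \<open>
  Finite simple graphs are the pair_graphs of Graph_Theory: finite, loopless, without parallel
  arcs, and symmetric, so that an edge between u and v is the pair of arcs (u, v) and (v, u).
\<close>

text \<open>By symmetry the out-degree is the number of neighbours.\<close>

abbreviation deg :: "'a pair_pre_digraph \<Rightarrow> 'a \<Rightarrow> nat" where
  "deg G v \<equiv> out_degree (with_proj G) v"

definition edges :: "'a pair_pre_digraph \<Rightarrow> 'a set set" where
  "edges G = {{u, v} |u v. (u, v) \<in> parcs G}"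

definition pendent_verts :: "'a pair_pre_digraph \<Rightarrow> 'a set" where
  "pendent_verts G = {v \<in> pverts G. deg G v = 1}"

definition internal_verts :: "'a pair_pre_digraph \<Rightarrow> 'a set" where
  "internal_verts G = {v \<in> pverts G. deg G v \<noteq> 1}"

text \<open>Edges have two distinct endpoints, so the inner sums are the degree sums of the endpoints.\<close>

definition ABS :: "'a pair_pre_digraph \<Rightarrow> real" where
  "ABS G = (\<Sum>e\<in>edges G. sqrt (((\<Sum>v\<in>e. real (deg G v)) - 2) / (\<Sum>v\<in>e. real (deg G v))))"

definition graph_iso :: "'a pair_pre_digraph \<Rightarrow> 'b pair_pre_digraph \<Rightarrow> bool" where
  "graph_iso G H \<longleftrightarrow> digraph_iso (with_proj G) (with_proj H)"

text \<open>The simple graph on V whose edges are the pairs related by R in either order.\<close>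

definition simple_graph :: "'a set \<Rightarrow> ('a \<Rightarrow> 'a \<Rightarrow> bool) \<Rightarrow> 'a pair_pre_digraph" where
  "simple_graph V R =
     \<lparr>pverts = V, parcs = {(u, v). u \<in> V \<and> v \<in> V \<and> u \<noteq> v \<and> (R u v \<or> R v u)}\<rparr>"

text \<open>The star with k edges, hence of order k + 1; its centre is 0.\<close>

definition star :: "nat \<Rightarrow> nat pair_pre_digraph" where
  "star k = simple_graph {..<k + 1} (\<lambda>u v. u = 0)"

text \<open>
  The double star of order a + b, for a, b \<ge> 2: the internal vertices 0 and 1 have degrees a and b;
  the a - 1 vertices from 2 to a are attached to 0, the remaining b - 1 vertices to 1.
\<close>

definition double_star :: "nat \<Rightarrow> nat \<Rightarrow> nat pair_pre_digraph" where
  "double_star a b = simple_graph {..<a + b} (\<lambda>u v. u = 0 \<and> v \<le> a \<or> u = 1 \<and> a < v)"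

text \<open>
  The complete graph on the vertices below m, with p pendent vertices attached to vertex 0; for
  m \<ge> 3 the vertices below m are exactly the internal ones.
\<close>

definition complete_pendent :: "nat \<Rightarrow> nat \<Rightarrow> nat pair_pre_digraph" where
  "complete_pendent m p = simple_graph {..<m + p} (\<lambda>u v. u < m \<and> v < m \<or> u = 0 \<and> m \<le> v)"

lemma pair_graph_simple_graph:
  assumes "finite V"
  shows "pair_graph (simple_graph V R)"
proof -
  have "parcs (simple_graph V R) \<subseteq> V \<times> V" by (auto simp: simple_graph_def)
  then have "finite (parcs (simple_graph V R))" by (rule finite_subset) (use assms in simp)
  with assms show ?thesis
    by unfold_locales (auto simp: simple_graph_def symmetric_def sym_def)
qed

lemma pair_graph_models:
  "pair_graph (star k)" "pair_graph (double_star a b)" "pair_graph (complete_pendent m p)"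
  by (simp_all add: star_def double_star_def complete_pendent_def pair_graph_simple_graph)

lemma deg_simple_graph:
  "deg (simple_graph V R) u = (if u \<in> V then card {v \<in> V. u \<noteq> v \<and> (R u v \<or> R v u)} else 0)"
proof -
  let ?N = "{v \<in> V. u \<noteq> v \<and> (R u v \<or> R v u)}"
  have "out_arcs (with_proj (simple_graph V R)) u = (if u \<in> V then Pair u ` ?N else {})"
    by (auto simp: out_arcs_def simple_graph_def)
  then show ?thesis by (simp add: out_degree_def card_image inj_on_def)
qed

lemma deg_double_star:
  assumes "2 \<le> a" "2 \<le> b" "u < a + b"
  shows "deg (double_star a b) u = (if u = 0 then a else if u = 1 then b else 1)"
proof -
  have N: "{v \<in> {..<a + b}. u \<noteq> v \<and> ((u = 0 \<and> v \<le> a \<or> u = 1 \<and> a < v) \<or> (v = 0 \<and> u \<le> a \<or> v = 1 \<and> a < u))}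
      = (if u = 0 then {1..a} else if u = 1 then insert 0 {a<..<a + b}
         else if u \<le> a then {0} else {1})"
    using assms by auto
  show ?thesis
    unfolding double_star_def deg_simple_graph N using assms by simp
qed

lemma deg_complete_pendent:
  assumes "3 \<le> m" "u < m + p"
  shows "deg (complete_pendent m p) u = (if u = 0 then m + p - 1 else if u < m then m - 1 else 1)"
proof -
  have N: "{v \<in> {..<m + p}. u \<noteq> v \<and> ((u < m \<and> v < m \<or> u = 0 \<and> m \<le> v) \<or> (v < m \<and> u < m \<or> v = 0 \<and> m \<le> u))}
      = (if u = 0 then {1..<m + p} else if u < m then {..<m} - {u} else {0})"
    using assms by auto
  show ?thesis
    unfolding complete_pendent_def deg_simple_graph N using assms by simp
qed

lemma pverts_models:
  "pverts (star k) = {..<k + 1}"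
  "pverts (double_star a b) = {..<a + b}"
  "pverts (complete_pendent m p) = {..<m + p}"
  by (simp_all add: star_def double_star_def complete_pendent_def simple_graph_def)

lemma internal_verts_double_star:
  "2 \<le> a \<Longrightarrow> 2 \<le> b \<Longrightarrow> internal_verts (double_star a b) = {0, 1}"
  by (auto simp: internal_verts_def pverts_models deg_double_star split: if_splits)

lemma internal_verts_complete_pendent:
  "3 \<le> m \<Longrightarrow> internal_verts (complete_pendent m p) = {..<m}"
  by (auto simp: internal_verts_def pverts_models deg_complete_pendent split: if_splits)

end

theory Submission
  imports Defs "HOL-Library.Disjoint_Sets"
begin

text \<open>
  No two pendent vertices are adjacent, and the weight of an edge increases with its degree sum, so
  making the internal vertices a clique strictly increases the index. The index of the resulting
  graph depends only on the numbers of pendent vertices at the internal vertices, and by a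
  convexity argument moving all pendent vertices to one internal vertex strictly increases it.
  With two internal vertices each of them must keep a pendent vertex, and the same convexity puts
  all remaining ones on one side. A graph with an internal clique is determined up to
  isomorphism by the degrees of its internal vertices, which yields the equality cases.
\<close>

text \<open>Write f for the edge weight as a function of the degree sum. The obstacle to
  concentrating the pendent vertices is that f is concave: moving all pendent vertices from j to i
  increases the weights of the pendent edges and keeps that of the edge ij, but it lowers the total
  weight of the two edges from i and j to any third internal vertex. These losses must be paid for
  by the pendent edges. With m internal vertices there are m - 2 third vertices, and x f(x + m) =
  H(x + m) - (m - 2) f(x + m) with H(s) = (s - 2) f(s), so each third vertex k can be given one copy
  of f(x + m). The difference f(x + c_k) - f(x + m) is convex in x because f' is convex and c_k > m,
  and H is strictly convex. Thus every piece gains by merging, which explains why derivatives of f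
  up to second order are studied.\<close>

section \<open>Analysis of the edge weight and its convexity properties\<close>

text \<open>The increment \<open>h t = g (t + b) - g t\<close> has positive derivative, so it is
  larger at \<open>x + a\<close> than at \<open>x\<close>. This is strict convexity in the form in
  which two entries with fixed sum are merged.\<close>

lemma supermodular_of_strict_mono_deriv:
  fixes g g' :: "real \<Rightarrow> real"
  assumes deriv: "\<And>x. l < x \<Longrightarrow> (g has_real_derivative g' x) (at x)"
    and mono: "\<And>x y. l < x \<Longrightarrow> x < y \<Longrightarrow> g' x < g' y"
    and "l < x" "0 < a" "0 < b"
  shows "g (x + a) + g (x + b) < g x + g (x + a + b)"
proof -
  define h where "h t = g (t + b) - g t" for t
  have "h x < h (x + a)"
  proof (rule DERIV_pos_imp_increasing[where f = h])
    fix t assume "x \<le> t" "t \<le> x + a"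
    then have t: "l < t" using assms by simp
    have "((\<lambda>t. g (t + b)) has_real_derivative g' (t + b)) (at t)"
      using deriv[of "t + b"] t \<open>0 < b\<close> by (simp add: DERIV_shift)
    then have "(h has_real_derivative g' (t + b) - g' t) (at t)"
      unfolding h_def using deriv[OF t] by (intro DERIV_diff)
    then show "\<exists>y. (h has_real_derivative y) (at t) \<and> 0 < y"
      using mono[OF t, of "t + b"] \<open>0 < b\<close> by (intro exI[of _ "g' (t + b) - g' t"]) simp
  qed (use assms in simp)
  then show ?thesis by (simp add: h_def algebra_simps)
qed

definition abs_weight :: "real \<Rightarrow> real" where
  "abs_weight s = sqrt ((s - 2) / s)"

text \<open>Differentiating f^2 = 1 - 2/s gives 2 f f' = 2/s^2; keeping f itself in the formula
  avoids nested roots in the second derivative.\<close>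

definition abs_weight_deriv :: "real \<Rightarrow> real" where
  "abs_weight_deriv s = 1 / (s\<^sup>2 * abs_weight s)"

lemma abs_weight_pos: "2 < s \<Longrightarrow> 0 < abs_weight s"
  by (simp add: abs_weight_def)

lemma abs_weight_less: "2 \<le> s \<Longrightarrow> s < t \<Longrightarrow> abs_weight s < abs_weight t"
  by (simp add: abs_weight_def field_simps)

lemma abs_weight_le: "2 \<le> s \<Longrightarrow> s \<le> t \<Longrightarrow> abs_weight s \<le> abs_weight t"
  using abs_weight_less[of s t] by (cases "s = t") auto

lemma abs_weight_sq: "2 < s \<Longrightarrow> (abs_weight s)\<^sup>2 = (s - 2) / s"
  by (simp add: abs_weight_def)

lemma DERIV_abs_weight:
  assumes "2 < s"
  shows "(abs_weight has_real_derivative abs_weight_deriv s) (at s)"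
proof -
  have "((\<lambda>s. (s - 2) / s) has_real_derivative 2 / s\<^sup>2) (at s)"
    using assms by (auto intro!: derivative_eq_intros simp: field_simps power2_eq_square)
  from DERIV_chain2[OF DERIV_real_sqrt this] assms
  have "((\<lambda>s. sqrt ((s - 2) / s)) has_real_derivative inverse (sqrt ((s - 2) / s)) / 2 * (2 / s\<^sup>2)) (at s)"
    by simp
  then show ?thesis
    unfolding abs_weight_deriv_def abs_weight_def[abs_def] by (simp add: field_simps)
qed

text \<open>The second derivative is written as minus a sum of reciprocals of products of increasing
  positive functions, so its sign and its monotonicity can be read off without a third
  derivative.\<close>

lemma DERIV_abs_weight_deriv:
  assumes "2 < s"
  shows "(abs_weight_deriv has_real_derivative
    - (2 / (s ^ 3 * abs_weight s) + 1 / (s ^ 4 * abs_weight s ^ 3))) (at s)"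
proof -
  note [derivative_intros] = DERIV_abs_weight[OF assms]
  have pos: "abs_weight s > 0" using assms by (rule abs_weight_pos)
  have "((\<lambda>s. 1 / (s\<^sup>2 * abs_weight s)) has_real_derivative
     - ((2 * s * abs_weight s + s\<^sup>2 * abs_weight_deriv s) / (s\<^sup>2 * abs_weight s)\<^sup>2)) (at s)"
    using pos assms by (auto intro!: derivative_eq_intros simp: power2_eq_square divide_simps)
  moreover have "(2 * s * abs_weight s + s\<^sup>2 * abs_weight_deriv s) / (s\<^sup>2 * abs_weight s)\<^sup>2
     = 2 / (s ^ 3 * abs_weight s) + 1 / (s ^ 4 * abs_weight s ^ 3)"
    using pos assms
    by (simp add: abs_weight_deriv_def divide_simps) (simp add: algebra_simps eval_nat_numeral)
  ultimately show ?thesis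
    unfolding abs_weight_deriv_def[abs_def] by simp
qed

lemma abs_weight_deriv_supermodular:
  assumes "2 < s" "0 < a" "0 < b"
  shows "abs_weight_deriv (s + a) + abs_weight_deriv (s + b) < abs_weight_deriv s + abs_weight_deriv (s + a + b)"
proof (rule supermodular_of_strict_mono_deriv[where l = 2])
  fix x y :: real assume xy: "2 < x" "x < y"
  have p: "0 < abs_weight x" "abs_weight x < abs_weight y"
    using xy by (auto intro: abs_weight_pos abs_weight_less)
  have "2 / (y ^ 3 * abs_weight y) < 2 / (x ^ 3 * abs_weight x)"
    using xy p by (intro divide_strict_left_mono mult_strict_mono power_strict_mono) auto
  moreover have "1 / (y ^ 4 * abs_weight y ^ 3) < 1 / (x ^ 4 * abs_weight x ^ 3)"
    using xy p by (intro divide_strict_left_mono mult_strict_mono power_strict_mono) auto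
  ultimately show "- (2 / (x ^ 3 * abs_weight x) + 1 / (x ^ 4 * abs_weight x ^ 3))
      < - (2 / (y ^ 3 * abs_weight y) + 1 / (y ^ 4 * abs_weight y ^ 3))" by simp
qed (use assms DERIV_abs_weight_deriv in auto)

text \<open>The derivative of \<open>D\<close> at x is f'(x + e) - f'(x), and this increases with x
  by the strict convexity of f'. Applied to the edges to a third internal vertex, \<open>e\<close>
  is the excess of their degree sum over that of a pendent edge.\<close>

lemma abs_weight_diff_supermodular:
  assumes "2 < s" "0 < e" "0 < a" "0 < b"
  defines "D \<equiv> \<lambda>s. abs_weight (s + e) - abs_weight s"
  shows "D (s + a) + D (s + b) < D s + D (s + a + b)"
proof (rule supermodular_of_strict_mono_deriv[where l = 2])
  fix x :: real assume x: "2 < x"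
  have "((\<lambda>t. abs_weight (t + e)) has_real_derivative abs_weight_deriv (x + e)) (at x)"
    using DERIV_abs_weight[of "x + e"] x \<open>0 < e\<close> by (simp add: DERIV_shift)
  then show "(D has_real_derivative abs_weight_deriv (x + e) - abs_weight_deriv x) (at x)"
    unfolding D_def using DERIV_abs_weight[OF x] by (intro DERIV_diff)
next
  fix x y :: real assume "2 < x" "x < y"
  with abs_weight_deriv_supermodular[of x "y - x" e] \<open>0 < e\<close>
  show "abs_weight_deriv (x + e) - abs_weight_deriv x < abs_weight_deriv (y + e) - abs_weight_deriv y"
    by simp
qed (use assms in auto)

lemma scaled_abs_weight_supermodular:
  assumes "2 < s" "0 < a" "0 < b"
  defines "H \<equiv> \<lambda>s. (s - 2) * abs_weight s"
  shows "H (s + a) + H (s + b) < H s + H (s + a + b)"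
proof (rule supermodular_of_strict_mono_deriv[where l = 2])
  fix x :: real assume x: "2 < x"
  note [derivative_intros] = DERIV_abs_weight[OF x]
  have pos: "abs_weight x > 0" using x by (rule abs_weight_pos)
  have "(x - 2) * abs_weight_deriv x = abs_weight x / x"
  proof -
    have "x - 2 = x * (abs_weight x)\<^sup>2" using abs_weight_sq[OF x] x by simp
    then show ?thesis using pos x by (simp add: abs_weight_deriv_def power2_eq_square)
  qed
  then show "(H has_real_derivative abs_weight x * (1 + 1 / x)) (at x)"
    unfolding H_def using x by (auto intro!: derivative_eq_intros simp: algebra_simps)
next
  fix x y :: real assume xy: "2 < x" "x < y"
  \<comment> \<open>Squaring removes the root: (1 - 2/t)(1 + 1/t)^2 has no term of order 1/t, and
    the remaining non-constant terms are negative, so monotonicity is immediate.\<close>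
  have sq: "(abs_weight t * (1 + 1 / t))\<^sup>2 = 1 - 3 / t ^ 2 - 2 / t ^ 3" if "2 < t" for t
    using that unfolding power_mult_distrib abs_weight_sq[OF that]
    by (simp add: divide_simps) (simp add: algebra_simps eval_nat_numeral)
  have "3 / y ^ 2 < 3 / x ^ 2" "2 / y ^ 3 < 2 / x ^ 3"
    using xy by (auto intro!: divide_strict_left_mono power_strict_mono)
  then have "(abs_weight x * (1 + 1 / x))\<^sup>2 < (abs_weight y * (1 + 1 / y))\<^sup>2"
    using xy by (simp add: sq)
  then show "abs_weight x * (1 + 1 / x) < abs_weight y * (1 + 1 / y)"
    by (rule power_less_imp_less_base) (use xy abs_weight_pos[of y] in simp)
qed (use assms in auto)

section \<open>The index of a clique with pendent vertices, as a function of their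
  distribution\<close>

text \<open>The double sum runs over ordered pairs, so by symmetry every pair containing
  \<open>i\<close> occurs twice.\<close>

lemma sum_off_diag_insert:
  fixes w :: "'a \<Rightarrow> 'a \<Rightarrow> real"
  assumes "finite J" "i \<notin> J" and sym: "\<And>k l. w k l = w l k"
  shows "(\<Sum>k\<in>insert i J. \<Sum>l\<in>insert i J - {k}. w k l)
    = 2 * (\<Sum>l\<in>J. w i l) + (\<Sum>k\<in>J. \<Sum>l\<in>J - {k}. w k l)"
proof -
  have "(\<Sum>l\<in>insert i J - {k}. w k l) = w i k + (\<Sum>l\<in>J - {k}. w k l)" if "k \<in> J" for k
  proof -
    have "insert i J - {k} = insert i (J - {k})" using that assms by auto
    then show ?thesis using assms by (simp add: sym[of k])
  qed
  then have "(\<Sum>k\<in>J. \<Sum>l\<in>insert i J - {k}. w k l)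
      = (\<Sum>k\<in>J. w i k) + (\<Sum>k\<in>J. \<Sum>l\<in>J - {k}. w k l)"
    by (simp add: sum.distrib)
  then show ?thesis using assms by simp
qed

text \<open>
  The index of the graph in which I is a clique of internal vertices and every i in I carries
  p i pendent vertices.
\<close>

definition clique_abs :: "'a set \<Rightarrow> ('a \<Rightarrow> nat) \<Rightarrow> real" where
  "clique_abs I p = (\<Sum>i\<in>I. real (p i) * abs_weight (real (p i) + real (card I)))
     + (\<Sum>i\<in>I. \<Sum>j\<in>I - {i}. abs_weight (real (p i) + real (p j) + 2 * real (card I) - 2)) / 2"

text \<open>The three terms count the pendent edges, the m - 1 internal edges at \<open>i\<close>,
  and the remaining (m - 1)(m - 2)/2 internal edges. The case m = 1 is included and serves for the
  star.\<close>

lemma clique_abs_concentrated: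
  assumes "finite I" "i \<in> I" "\<And>j. j \<in> I - {i} \<Longrightarrow> p j = 0"
  defines "m \<equiv> real (card I)" and "q \<equiv> real (p i)"
  shows "clique_abs I p = q * abs_weight (q + m) + (m - 1) * abs_weight (q + 2 * m - 2)
    + (m - 1) * (m - 2) / 2 * abs_weight (2 * m - 2)"
proof -
  let ?J = "I - {i}"
  have I: "I = insert i ?J" "finite ?J" "i \<notin> ?J" using assms by auto
  have card: "real (card ?J) = m - 1"
  proof -
    have "card I = Suc (card ?J)" using assms by (metis card_Suc_Diff1)
    then show ?thesis by (simp add: m_def)
  qed
  have cardk: "real (card (?J - {k})) = m - 2" if "k \<in> ?J" for k
  proof -
    have "card ?J = Suc (card (?J - {k}))" using I(2) that by (metis card_Suc_Diff1)
    then show ?thesis using card by simp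
  qed
  have "(\<Sum>i\<in>I. real (p i) * abs_weight (real (p i) + m)) = q * abs_weight (q + m)"
    by (subst I(1), subst sum.insert) (use I assms(3) in \<open>auto simp: q_def\<close>)
  moreover have "(\<Sum>i\<in>I. \<Sum>j\<in>I - {i}. abs_weight (real (p i) + real (p j) + 2 * m - 2))
     = 2 * (\<Sum>l\<in>?J. abs_weight (q + real (p l) + 2 * m - 2))
      + (\<Sum>k\<in>?J. \<Sum>l\<in>?J - {k}. abs_weight (real (p k) + real (p l) + 2 * m - 2))"
    using sum_off_diag_insert[of ?J i "\<lambda>i j. abs_weight (real (p i) + real (p j) + 2 * m - 2)"] I
    by (simp add: q_def add.commute)
  moreover have "(\<Sum>l\<in>?J. abs_weight (q + real (p l) + 2 * m - 2)) = (m - 1) * abs_weight (q + 2 * m - 2)"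
    using assms(3) card by simp
  moreover have "(\<Sum>k\<in>?J. \<Sum>l\<in>?J - {k}. abs_weight (real (p k) + real (p l) + 2 * m - 2))
      = (\<Sum>k\<in>?J. (m - 2) * abs_weight (2 * m - 2))"
    using assms(3) cardk by (intro sum.cong refl) simp
  ultimately show ?thesis
    unfolding clique_abs_def m_def[symmetric] using card by (simp add: add_divide_distrib)
qed

text \<open>
  The dependence on two entries x and y with fixed sum is strictly supermodular: it is
  $H(x + m) + \sum_k (f(x + c_k) - f(x + m))$ plus the same expression in y, where $f$ is the
  weight and $H(s) = (s - 2) f(s)$.
\<close>

lemma clique_abs_merge:
  assumes fin: "finite I" and ij: "i \<in> I" "j \<in> I" "i \<noteq> j" and pos: "0 < p i" "0 < p j"
    and card: "3 \<le> card I"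
  shows "clique_abs I p < clique_abs I (p(i := p i + p j, j := 0))"
proof -
  define m where "m = real (card I)"
  define K where "K = I - {i, j}"
  define H where "H s = (s - 2) * abs_weight s" for s :: real
  define x where "x = real (p i)"
  define y where "y = real (p j)"
  define c where "c k = real (p k) + 2 * m - 2" for k
  let ?q = "p(i := p i + p j, j := 0)"
  have xy: "0 < x" "0 < y" and m: "3 \<le> m" using pos card by (auto simp: x_def y_def m_def)
  have K: "I = insert i (insert j K)" "finite K" "i \<notin> insert j K" "j \<notin> K" "finite (insert j K)" "i \<notin> K"
    using fin ij by (auto simp: K_def)
  have cardK: "real (card K) = m - 2" using K ij by (simp add: m_def)
  define R where "R = (\<Sum>k\<in>K. real (p k) * abs_weight (real (p k) + m))
    + (\<Sum>k\<in>K. \<Sum>l\<in>K - {k}. abs_weight (real (p k) + real (p l) + 2 * m - 2)) / 2"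
  \<comment> \<open>Stated for arbitrary new values at \<open>i\<close> and \<open>j\<close>, so
    that one computation evaluates both the original and the merged distribution; \<open>R\<close>
    collects the edges that meet neither \<open>i\<close> nor \<open>j\<close>.\<close>
  have split: "clique_abs I r = u * abs_weight (u + m) + v * abs_weight (v + m)
      + abs_weight (u + v + 2 * m - 2)
      + (\<Sum>k\<in>K. abs_weight (c k + u) + abs_weight (c k + v)) + R"
    if r: "r = p(i := a, j := b)" and uv: "u = real a" "v = real b" for r a b u v
  proof -
    let ?w = "\<lambda>k l. abs_weight (real (r k) + real (r l) + 2 * m - 2)"
    have ri: "r i = a" and rj: "r j = b" and rk: "\<And>k. k \<in> K \<Longrightarrow> r k = p k"
      using K ij by (auto simp: r)
    have "(\<Sum>k\<in>I. \<Sum>l\<in>I - {k}. ?w k l) = 2 * (\<Sum>l\<in>insert j K. ?w i l)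
        + 2 * (\<Sum>l\<in>K. ?w j l) + (\<Sum>k\<in>K. \<Sum>l\<in>K - {k}. ?w k l)"
      using sum_off_diag_insert[of "insert j K" i ?w] sum_off_diag_insert[of K j ?w] K
      by (simp add: add_ac)
    also have "(\<Sum>k\<in>K. \<Sum>l\<in>K - {k}. ?w k l)
        = (\<Sum>k\<in>K. \<Sum>l\<in>K - {k}. abs_weight (real (p k) + real (p l) + 2 * m - 2))"
      by (intro sum.cong refl) (simp add: rk)
    also have "(\<Sum>l\<in>insert j K. ?w i l) = abs_weight (u + v + 2 * m - 2) + (\<Sum>k\<in>K. abs_weight (c k + u))"
      using K by (simp add: ri rj uv rk c_def algebra_simps)
    also have "(\<Sum>l\<in>K. ?w j l) = (\<Sum>k\<in>K. abs_weight (c k + v))"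
      using K by (intro sum.cong refl) (simp add: rj uv rk c_def algebra_simps)
    finally have A: "(\<Sum>k\<in>I. \<Sum>l\<in>I - {k}. ?w k l) / 2
      = abs_weight (u + v + 2 * m - 2) + (\<Sum>k\<in>K. abs_weight (c k + u)) + (\<Sum>k\<in>K. abs_weight (c k + v))
       + (\<Sum>k\<in>K. \<Sum>l\<in>K - {k}. abs_weight (real (p k) + real (p l) + 2 * m - 2)) / 2"
      by simp
    have B: "(\<Sum>k\<in>I. real (r k) * abs_weight (real (r k) + m))
      = u * abs_weight (u + m) + v * abs_weight (v + m) + (\<Sum>k\<in>K. real (p k) * abs_weight (real (p k) + m))"
      unfolding K(1) using K by (simp add: ri rj uv rk)
    show ?thesis
      unfolding clique_abs_def m_def[symmetric] A B R_def by (simp add: sum.distrib)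
  qed
  have e1: "clique_abs I p = x * abs_weight (x + m) + y * abs_weight (y + m)
      + abs_weight (x + y + 2 * m - 2)
      + (\<Sum>k\<in>K. abs_weight (c k + x) + abs_weight (c k + y)) + R"
    by (rule split[of _ "p i" "p j"]) (simp_all add: x_def y_def)
  have e2: "clique_abs I ?q = (x + y) * abs_weight (x + y + m) + 0 * abs_weight (0 + m)
      + abs_weight (x + y + 0 + 2 * m - 2)
      + (\<Sum>k\<in>K. abs_weight (c k + (x + y)) + abs_weight (c k + 0)) + R"
    by (rule split[of _ "p i + p j" 0]) (simp_all add: x_def y_def)
  have H: "H (m + x) + H (m + y) < H m + H (m + x + y)"
    unfolding H_def using scaled_abs_weight_supermodular[of m x y] xy m by simp
  \<comment> \<open>A weak inequality suffices here, since the strict gain comes from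
    \<open>H\<close>.\<close>
  have D: "(\<Sum>k\<in>K. abs_weight (c k + x) - abs_weight (m + x) + (abs_weight (c k + y) - abs_weight (m + y)))
    \<le> (\<Sum>k\<in>K. abs_weight (c k) - abs_weight m + (abs_weight (c k + x + y) - abs_weight (m + x + y)))"
  proof (rule sum_mono)
    fix k
    have "0 < c k - m" using m by (simp add: c_def)
    from abs_weight_diff_supermodular[OF _ this xy, of m] m
    show "abs_weight (c k + x) - abs_weight (m + x) + (abs_weight (c k + y) - abs_weight (m + y))
      \<le> abs_weight (c k) - abs_weight m + (abs_weight (c k + x + y) - abs_weight (m + x + y))"
      by (simp add: algebra_simps)
  qed
  \<comment> \<open>The m - 2 copies of the subtracted weight match the m - 2 elements of
    \<open>K\<close>, which turns the sums over \<open>K\<close> into those compared in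
    \<open>D\<close>.\<close>
  have h: "t * abs_weight (t + m) = H (m + t) - (m - 2) * abs_weight (m + t)" for t
    by (simp add: H_def algebra_simps)
  show ?thesis
    using H D unfolding e1 e2 h
    by (simp add: sum.distrib sum_subtractf cardK) (simp add: algebra_simps H_def)
qed

text \<open>Each merge empties one vertex and keeps the total, so induction on the number of
  vertices carrying pendent vertices ends in a concentrated distribution. As every merge is strict,
  only concentrated distributions attain the maximum.\<close>

lemma clique_abs_max:
  fixes p :: "'a \<Rightarrow> nat"
  assumes fin: "finite I" and card: "3 \<le> card I"
  defines "m \<equiv> real (card I)" and "q \<equiv> real (sum p I)"
  defines "M \<equiv> q * abs_weight (q + m) + (m - 1) * abs_weight (q + 2 * m - 2)
    + (m - 1) * (m - 2) / 2 * abs_weight (2 * m - 2)"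
  shows "clique_abs I p \<le> M \<and> (clique_abs I p = M \<longleftrightarrow> (\<exists>i\<in>I. \<forall>j\<in>I - {i}. p j = 0))"
  unfolding M_def q_def
proof (induction "card {i\<in>I. 0 < p i}" arbitrary: p rule: less_induct)
  case less
  show ?case
  proof (cases "\<exists>i\<in>I. \<forall>j\<in>I - {i}. p j = 0")
    case True
    then obtain i where i: "i \<in> I" "\<And>j. j \<in> I - {i} \<Longrightarrow> p j = 0" by blast
    have "sum p I = p i" using fin i by (simp add: sum.remove)
    then show ?thesis using True clique_abs_concentrated[OF fin i] by (simp add: m_def)
  next
    case False
    \<comment> \<open>Failure of concentration at \<open>i0\<close> yields a vertex \<open>i\<close>
      with a positive entry; failure at \<open>i\<close> then yields a second one to merge with
      it.\<close>
    obtain i0 where "i0 \<in> I" using card by (cases "I = {}") auto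
    obtain i where i: "i \<in> I" "0 < p i" using False \<open>i0 \<in> I\<close> by blast
    then obtain j where j: "j \<in> I" "j \<noteq> i" "0 < p j" using False by blast
    let ?q = "p(i := p i + p j, j := 0)"
    have "{k\<in>I. 0 < ?q k} \<subset> {k\<in>I. 0 < p k}" using i j by (auto split: if_splits)
    then have "card {k\<in>I. 0 < ?q k} < card {k\<in>I. 0 < p k}"
      using fin by (intro psubset_card_mono) auto
    note IH = less[OF this]
    have "sum ?q I = sum p I"
    proof -
      have I: "I = insert i (insert j (I - {i, j}))" using i j by auto
      have "sum ?q (I - {i, j}) = sum p (I - {i, j})" by (rule sum.cong) auto
      then show ?thesis
        by (subst (1 2) I) (use i j fin in simp)
    qed
    note IH = IH[unfolded this]
    have "clique_abs I p < clique_abs I ?q"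
      using i j fin card by (intro clique_abs_merge) auto
    with IH False show ?thesis by linarith
  qed
qed

section \<open>Internal and pendent vertices of a graph\<close>

definition hang :: "'a pair_pre_digraph \<Rightarrow> 'a \<Rightarrow> 'a set" where
  "hang G i = {v \<in> pendent_verts G. (i, v) \<in> parcs G}"

definition internal_nbrs :: "'a pair_pre_digraph \<Rightarrow> 'a \<Rightarrow> 'a set" where
  "internal_nbrs G i = {j \<in> internal_verts G. (i, j) \<in> parcs G}"

definition internal_clique :: "'a pair_pre_digraph \<Rightarrow> bool" where
  "internal_clique G \<longleftrightarrow> (\<forall>u\<in>internal_verts G. \<forall>v\<in>internal_verts G. u \<noteq> v \<longrightarrow> (u, v) \<in> parcs G)"

definition pendent_independent :: "'a pair_pre_digraph \<Rightarrow> bool" where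
  "pendent_independent G \<longleftrightarrow> (\<forall>u\<in>pendent_verts G. \<forall>v\<in>pendent_verts G. (u, v) \<notin> parcs G)"

lemma deg_eq_card: "deg G u = card {v. (u, v) \<in> parcs G}"
proof -
  have "out_arcs (with_proj G) u = Pair u ` {v. (u, v) \<in> parcs G}"
    by (auto simp: out_arcs_def)
  then show ?thesis by (simp add: out_degree_def card_image inj_on_def)
qed

lemma pverts_split: "pverts G = internal_verts G \<union> pendent_verts G" "internal_verts G \<inter> pendent_verts G = {}"
  by (auto simp: internal_verts_def pendent_verts_def)

text \<open>Connectedness is defined by reachability in the symmetric closure, which adds no arcs to
  a symmetric graph; hence a set closed under neighbours contains every vertex reachable from
  it.\<close>

lemma connected_closed_eq:
  assumes "pair_graph G" "Digraph_Component.connected (with_proj G)"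
    and "S \<subseteq> pverts G" "S \<noteq> {}" and closed: "\<And>u v. u \<in> S \<Longrightarrow> (u, v) \<in> parcs G \<Longrightarrow> v \<in> S"
  shows "S = pverts G"
proof -
  interpret pair_graph G by fact
  obtain u where u: "u \<in> S" using assms by blast
  have "w \<in> S" if "w \<in> pverts G" for w
  proof -
    have "u \<rightarrow>\<^sup>*\<^bsub>mk_symmetric (with_proj G)\<^esub> w"
      using assms(2,3) u that by (auto simp: Digraph_Component.connected_def strongly_connected_def)
    then have "(u, w) \<in> (arcs_ends (with_proj (mk_symmetric (with_proj G))))\<^sup>*"
      by (rule reachable_rtranclI)
    then have "(u, w) \<in> (parcs (mk_symmetric (with_proj G)))\<^sup>*"
      by (simp only: with_proj_simps)
    then show ?thesis
      by induction (use u closed in \<open>auto simp: parcs_mk_symmetric dest: arcs_symmetric\<close>)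
  qed
  then show ?thesis using assms by blast
qed

context
  fixes G :: "'a pair_pre_digraph"
  assumes G: "pair_graph G"
begin

interpretation pair_graph G by (rule G)

lemma finite_verts_parts: "finite (internal_verts G)" "finite (pendent_verts G)" "finite (hang G i)" "finite (internal_nbrs G i)"
  using pair_finite_verts by (simp_all add: internal_verts_def pendent_verts_def hang_def internal_nbrs_def)

lemma card_pverts: "card (pverts G) = card (internal_verts G) + card (pendent_verts G)"
  using pverts_split[of G] finite_verts_parts by (simp add: card_Un_disjoint)

lemma pendent_nbr:
  assumes "v \<in> pendent_verts G"
  obtains u where "{w. (v, w) \<in> parcs G} = {u}"
proof -
  have "card {w. (v, w) \<in> parcs G} = 1" using assms by (simp add: pendent_verts_def deg_eq_card)
  then show ?thesis using that by (auto simp: card_1_singleton_iff)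
qed

lemma pendent_nbr_unique:
  assumes "v \<in> pendent_verts G" "(v, x) \<in> parcs G" "(v, y) \<in> parcs G"
  shows "x = y"
proof -
  obtain u where "{w. (v, w) \<in> parcs G} = {u}" using assms(1) by (rule pendent_nbr)
  then have "x \<in> {u}" "y \<in> {u}" using assms(2,3) by (metis mem_Collect_eq)+
  then show ?thesis by simp
qed

lemma deg_split: "deg G i = card (hang G i) + card (internal_nbrs G i)"
proof -
  have "{v. (i, v) \<in> parcs G} = hang G i \<union> internal_nbrs G i"
    using pverts_split[of G] in_arcsD2 by (auto simp: hang_def internal_nbrs_def)
  moreover have "hang G i \<inter> internal_nbrs G i = {}"
    using pverts_split[of G] by (auto simp: hang_def internal_nbrs_def)
  ultimately show ?thesis
    by (simp add: deg_eq_card card_Un_disjoint finite_verts_parts)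
qed

lemma internal_nbrs_subset: "internal_nbrs G i \<subseteq> internal_verts G - {i}"
  using no_loops' by (auto simp: internal_nbrs_def)

lemma internal_clique_iff_nbrs:
  "internal_clique G \<longleftrightarrow> (\<forall>i\<in>internal_verts G. internal_nbrs G i = internal_verts G - {i})"
proof -
  have "internal_nbrs G i = internal_verts G - {i}
      \<longleftrightarrow> (\<forall>v\<in>internal_verts G. i \<noteq> v \<longrightarrow> (i, v) \<in> parcs G)" for i
    using internal_nbrs_subset[of i] by (auto simp: internal_nbrs_def)
  then show ?thesis by (simp add: internal_clique_def)
qed

lemma deg_internal_le:
  assumes "i \<in> internal_verts G"
  shows "deg G i + 1 \<le> card (hang G i) + card (internal_verts G)"
proof -
  have "card (internal_nbrs G i) \<le> card (internal_verts G - {i})"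
    using internal_nbrs_subset finite_verts_parts by (intro card_mono) auto
  moreover have "card (internal_verts G) = Suc (card (internal_verts G - {i}))"
    using assms finite_verts_parts by (metis card_Suc_Diff1)
  ultimately show ?thesis by (simp add: deg_split)
qed

lemma deg_internal_clique:
  assumes "internal_clique G" "i \<in> internal_verts G"
  shows "deg G i + 1 = card (hang G i) + card (internal_verts G)"
proof -
  have "card (internal_verts G) = Suc (card (internal_verts G - {i}))"
    using assms finite_verts_parts by (metis card_Suc_Diff1)
  then show ?thesis using assms by (simp add: deg_split internal_clique_iff_nbrs)
qed

text \<open>Two adjacent pendent vertices have no other neighbours and so form a whole component.
  The existence of an internal vertex excludes the single edge, the one connected graph where this
  happens.\<close>

lemma pendent_independent_if_connected:
  assumes con: "Digraph_Component.connected (with_proj G)" and ne: "internal_verts G \<noteq> {}"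
  shows "pendent_independent G"
  unfolding pendent_independent_def
proof (intro ballI notI)
  fix u v assume uv: "u \<in> pendent_verts G" "v \<in> pendent_verts G" "(u, v) \<in> parcs G"
  have nb: "w = v" if "(u, w) \<in> parcs G" for w
    by (rule pendent_nbr_unique[OF uv(1) that uv(3)])
  have nb': "w = u" if "(v, w) \<in> parcs G" for w
    by (rule pendent_nbr_unique[OF uv(2) that arcs_symmetric[OF uv(3)]])
  have "{u, v} = pverts G"
  proof (rule connected_closed_eq[OF G con])
    show "{u, v} \<subseteq> pverts G" using uv by (auto simp: pendent_verts_def)
    show "y \<in> {u, v}" if "x \<in> {u, v}" "(x, y) \<in> parcs G" for x y
      using that nb[of y] nb'[of y] by blast
  qed simp
  then show False using uv ne pverts_split[of G] by auto
qed

text \<open>The only neighbour of a pendent vertex is internal by independence, and its uniqueness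
  makes the sets disjoint.\<close>

lemma hang_partition:
  assumes "pendent_independent G"
  shows "(\<Union>i\<in>internal_verts G. hang G i) = pendent_verts G"
    and "disjoint_family (hang G)"
proof -
  show "(\<Union>i\<in>internal_verts G. hang G i) = pendent_verts G"
  proof (intro equalityI subsetI)
    fix v assume v: "v \<in> pendent_verts G"
    then obtain u where "(v, u) \<in> parcs G" by (rule pendent_nbr) blast
    then have "(u, v) \<in> parcs G" "u \<in> internal_verts G"
      using v assms in_arcsD2 pverts_split[of G] arcs_symmetric by (auto simp: pendent_independent_def)
    then show "v \<in> (\<Union>i\<in>internal_verts G. hang G i)" using v by (auto simp: hang_def)
  qed (auto simp: hang_def)
  show "disjoint_family (hang G)"
  proof (unfold disjoint_family_on_def, intro ballI impI)
    fix i j :: 'a assume "i \<noteq> j"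
    have False if "v \<in> hang G i" "v \<in> hang G j" for v
    proof -
      from that have "v \<in> pendent_verts G" "(v, i) \<in> parcs G" "(v, j) \<in> parcs G"
        by (auto simp: hang_def intro: arcs_symmetric)
      then show False using \<open>i \<noteq> j\<close> pendent_nbr_unique[of v i j] by simp
    qed
    then show "hang G i \<inter> hang G j = {}" by blast
  qed
qed

lemma hang_unique:
  "pendent_independent G \<Longrightarrow> v \<in> hang G i \<Longrightarrow> v \<in> hang G j \<Longrightarrow> i = j"
  using hang_partition(2) by (auto simp: disjoint_family_on_def)

lemma sum_card_hang:
  assumes "pendent_independent G"
  shows "(\<Sum>i\<in>internal_verts G. card (hang G i)) = card (pendent_verts G)"
proof -
  have "card (\<Union>i\<in>internal_verts G. hang G i) = (\<Sum>i\<in>internal_verts G. card (hang G i))"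
    using hang_partition(2)[OF assms] finite_verts_parts
    by (intro card_UN_disjoint) (auto simp: disjoint_family_on_def)
  then show ?thesis by (simp add: hang_partition(1)[OF assms])
qed

section \<open>The index split by edge type and compared with that of an internal clique\<close>

text \<open>Every edge is the image of exactly two arcs, the two being distinct because there are no
  loops.\<close>

lemma sum_edges:
  fixes w :: "'a set \<Rightarrow> real"
  shows "2 * (\<Sum>e\<in>edges G. w e) = (\<Sum>(u, v)\<in>parcs G. w {u, v})"
proof -
  let ?e = "\<lambda>(u, v). {u, v}"
  have E: "edges G = ?e ` parcs G" by (auto simp: edges_def)
  have "(\<Sum>a\<in>parcs G. w (?e a)) = (\<Sum>e\<in>?e ` parcs G. \<Sum>a | a \<in> parcs G \<and> ?e a = e. w (?e a))"
    by (rule sum.image_gen[OF pair_finite_arcs])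
  also have "\<dots> = (\<Sum>e\<in>edges G. 2 * w e)"
    unfolding E
  proof (rule sum.cong[OF refl])
    fix e assume "e \<in> ?e ` parcs G"
    then obtain u v where uv: "(u, v) \<in> parcs G" "e = {u, v}" by auto
    then have "{a \<in> parcs G. ?e a = e} = {(u, v), (v, u)}"
      using arcs_symmetric by (auto simp: doubleton_eq_iff)
    moreover have "u \<noteq> v" using uv no_loops' by blast
    ultimately show "(\<Sum>a | a \<in> parcs G \<and> ?e a = e. w (?e a)) = 2 * w e"
      using uv by (simp add: insert_commute)
  qed
  finally show ?thesis by (simp add: sum_distrib_left case_prod_unfold)
qed

text \<open>Independence leaves three kinds of arcs: internal ones (\<open>II\<close>), those from
  internal to pendent vertices (\<open>IP\<close>), and the reverses of the latter. After halving
  the arc sum, pendent edges count once while internal edges keep the factor 1/2.\<close>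

lemma ABS_decomp:
  assumes ind: "pendent_independent G"
  shows "ABS G = (\<Sum>i\<in>internal_verts G. card (hang G i) * abs_weight (real (deg G i) + 1))
    + (\<Sum>i\<in>internal_verts G. \<Sum>j\<in>internal_nbrs G i. abs_weight (real (deg G i) + real (deg G j))) / 2"
proof -
  let ?w = "\<lambda>u v. abs_weight (real (deg G u) + real (deg G v))"
  let ?I = "internal_verts G"
  define IP where "IP = Sigma ?I (hang G)"
  define II where "II = Sigma ?I (internal_nbrs G)"
  have "2 * ABS G = (\<Sum>(u, v)\<in>parcs G. ?w u v)"
    unfolding ABS_def sum_edges
  proof (rule sum.cong[OF refl], clarify)
    fix u v assume "(u, v) \<in> parcs G"
    then have "u \<noteq> v" by (rule no_loops')
    then show "sqrt (((\<Sum>v\<in>{u, v}. real (deg G v)) - 2) / (\<Sum>v\<in>{u, v}. real (deg G v))) = ?w u v"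
      by (simp add: abs_weight_def)
  qed
  also have "parcs G = II \<union> (IP \<union> prod.swap ` IP)"
  proof (intro equalityI subrelI)
    fix u v assume uv: "(u, v) \<in> parcs G"
    then have "(v, u) \<in> parcs G" "u \<in> pverts G" "v \<in> pverts G"
      using arcs_symmetric in_arcsD1 in_arcsD2 by blast+
    with uv ind show "(u, v) \<in> II \<union> (IP \<union> prod.swap ` IP)"
      unfolding II_def IP_def hang_def internal_nbrs_def pendent_independent_def pverts_split(1)
      by auto
  next
    fix u v assume "(u, v) \<in> II \<union> (IP \<union> prod.swap ` IP)"
    then show "(u, v) \<in> parcs G"
      by (auto simp: II_def IP_def hang_def internal_nbrs_def intro: arcs_symmetric)
  qed
  also have "(\<Sum>(u, v)\<in>\<dots>. ?w u v) = (\<Sum>(u, v)\<in>II. ?w u v) + ((\<Sum>(u, v)\<in>IP. ?w u v) + (\<Sum>(u, v)\<in>prod.swap ` IP. ?w u v))"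
  proof -
    have fin: "finite II" "finite IP" unfolding II_def IP_def using finite_verts_parts by auto
    have "II \<inter> (IP \<union> prod.swap ` IP) = {}" "IP \<inter> prod.swap ` IP = {}"
      using pverts_split(2)[of G] unfolding II_def IP_def hang_def internal_nbrs_def by auto
    then show ?thesis using fin by (simp add: sum.union_disjoint)
  qed
  also have "(\<Sum>(u, v)\<in>prod.swap ` IP. ?w u v) = (\<Sum>(u, v)\<in>IP. ?w u v)"
    by (subst sum.reindex) (auto simp: case_prod_unfold add.commute)
  also have "(\<Sum>(u, v)\<in>IP. ?w u v) = (\<Sum>i\<in>?I. \<Sum>v\<in>hang G i. ?w i v)"
    unfolding IP_def using finite_verts_parts by (subst sum.Sigma) auto
  also have "\<dots> = (\<Sum>i\<in>?I. card (hang G i) * abs_weight (real (deg G i) + 1))"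
  proof (rule sum.cong[OF refl])
    fix i
    have "(\<Sum>v\<in>hang G i. ?w i v) = (\<Sum>v\<in>hang G i. abs_weight (real (deg G i) + 1))"
      by (rule sum.cong) (auto simp: hang_def pendent_verts_def)
    then show "(\<Sum>v\<in>hang G i. ?w i v) = card (hang G i) * abs_weight (real (deg G i) + 1)" by simp
  qed
  also have "(\<Sum>(u, v)\<in>II. ?w u v) = (\<Sum>i\<in>?I. \<Sum>j\<in>internal_nbrs G i. ?w i j)"
    unfolding II_def using finite_verts_parts by (subst sum.Sigma) auto
  finally show ?thesis by simp
qed

lemma ABS_clique:
  assumes "pendent_independent G" "internal_clique G"
  shows "ABS G = clique_abs (internal_verts G) (\<lambda>i. card (hang G i))"
proof -
  have d: "real (deg G i) = real (card (hang G i)) + real (card (internal_verts G)) - 1"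
    if "i \<in> internal_verts G" for i
    using deg_internal_clique[OF assms(2) that] by linarith
  show ?thesis
    unfolding ABS_decomp[OF assms(1)] clique_abs_def
    using assms(2) by (intro arg_cong2[of _ _ _ _ "(+)"] arg_cong2[of _ _ _ _ "(/)"] refl sum.cong)
      (auto simp: d internal_clique_iff_nbrs algebra_simps)
qed

text \<open>Degrees never exceed those in the graph whose internal vertices are completed to a
  clique, so existing edges do not lose weight. Strictness comes from a missing internal edge: with
  at least three internal vertices its degree sum after completion is at least 4, so its weight is
  positive.\<close>

lemma ABS_less_clique:
  assumes ind: "pendent_independent G" and card: "3 \<le> card (internal_verts G)"
    and "\<not> internal_clique G"
  shows "ABS G < clique_abs (internal_verts G) (\<lambda>i. card (hang G i))"
proof -
  let ?I = "internal_verts G" and ?p = "\<lambda>i. real (card (hang G i))"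
  let ?m = "real (card ?I)"
  let ?w = "\<lambda>i j. abs_weight (?p i + ?p j + 2 * ?m - 2)"
  have d: "real (deg G i) + 1 \<le> ?p i + ?m" if "i \<in> ?I" for i
    using deg_internal_le[OF that] by linarith
  have pos: "0 < ?w i j" for i j
  proof (rule abs_weight_pos)
    have "0 \<le> ?p i" "0 \<le> ?p j" "3 \<le> ?m" using card by auto
    then show "2 < ?p i + ?p j + 2 * ?m - 2" by linarith
  qed
  have "(\<Sum>i\<in>?I. ?p i * abs_weight (real (deg G i) + 1)) \<le> (\<Sum>i\<in>?I. ?p i * abs_weight (?p i + ?m))"
  proof (rule sum_mono)
    fix i assume i: "i \<in> ?I"
    show "?p i * abs_weight (real (deg G i) + 1) \<le> ?p i * abs_weight (?p i + ?m)"
    \<comment> \<open>Monotonicity of the weight is available only from degree sum 2 on. A vertex of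
      degree 0 would violate this, but then the factor in front is zero.\<close>
    proof (cases "card (hang G i) = 0")
      case False
      then have "1 \<le> real (deg G i)" using deg_split[of i] by simp
      then show ?thesis using d[OF i] by (intro mult_left_mono abs_weight_le) auto
    qed simp
  qed
  moreover have "(\<Sum>i\<in>?I. \<Sum>j\<in>internal_nbrs G i. abs_weight (real (deg G i) + real (deg G j)))
     < (\<Sum>i\<in>?I. \<Sum>j\<in>?I - {i}. ?w i j)"
  proof (rule sum_strict_mono_ex1)
    have le: "(\<Sum>j\<in>internal_nbrs G i. abs_weight (real (deg G i) + real (deg G j)))
        \<le> (\<Sum>j\<in>internal_nbrs G i. ?w i j)" if i: "i \<in> ?I" for i
    proof (rule sum_mono)
      fix j assume j: "j \<in> internal_nbrs G i"
      \<comment> \<open>Both ends of an edge have positive degree, so the degree sum is at least 2,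
        as monotonicity of the weight requires.\<close>
      have "{v. (i, v) \<in> parcs G} \<subseteq> pverts G" "{v. (j, v) \<in> parcs G} \<subseteq> pverts G"
        using in_arcsD2 by auto
      then have "finite {v. (i, v) \<in> parcs G}" "finite {v. (j, v) \<in> parcs G}"
        using finite_subset[OF _ pair_finite_verts] by blast+
      moreover have "j \<in> {v. (i, v) \<in> parcs G}" "i \<in> {v. (j, v) \<in> parcs G}"
        using j by (auto simp: internal_nbrs_def intro: arcs_symmetric)
      ultimately have "0 < deg G i" "0 < deg G j"
        unfolding deg_eq_card by (auto simp only: card_gt_0_iff)
      moreover have "j \<in> ?I" using j by (simp add: internal_nbrs_def)
      ultimately show "abs_weight (real (deg G i) + real (deg G j)) \<le> ?w i j"
        using d[OF i] d[of j] by (intro abs_weight_le) linarith+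
    qed
    show "\<forall>i\<in>?I. (\<Sum>j\<in>internal_nbrs G i. abs_weight (real (deg G i) + real (deg G j)))
        \<le> (\<Sum>j\<in>?I - {i}. ?w i j)"
    proof
      fix i assume i: "i \<in> ?I"
      have "(\<Sum>j\<in>internal_nbrs G i. ?w i j) \<le> (\<Sum>j\<in>?I - {i}. ?w i j)"
        using internal_nbrs_subset finite_verts_parts pos by (intro sum_mono2) (auto intro: less_imp_le)
      with le[OF i] show "(\<Sum>j\<in>internal_nbrs G i. abs_weight (real (deg G i) + real (deg G j)))
        \<le> (\<Sum>j\<in>?I - {i}. ?w i j)" by linarith
    qed
    obtain i where i: "i \<in> ?I" "internal_nbrs G i \<noteq> ?I - {i}"
      using assms(3) by (auto simp: internal_clique_iff_nbrs)
    then obtain j where "j \<in> ?I - {i} - internal_nbrs G i" using internal_nbrs_subset by blast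
    then have "(\<Sum>j\<in>internal_nbrs G i. ?w i j) < (\<Sum>j\<in>?I - {i}. ?w i j)"
      using internal_nbrs_subset finite_verts_parts pos
      by (intro sum_strict_mono2[where b = j]) (auto intro: less_imp_le)
    with le[OF i(1)] i(1) show "\<exists>i\<in>?I. (\<Sum>j\<in>internal_nbrs G i. abs_weight (real (deg G i) + real (deg G j)))
        < (\<Sum>j\<in>?I - {i}. ?w i j)" by (intro bexI[of _ i]) linarith+
  qed (use finite_verts_parts in auto)
  ultimately show ?thesis
    unfolding ABS_decomp[OF ind] clique_abs_def by simp
qed

end

section \<open>Isomorphisms of graphs and their internal vertices\<close>

text \<open>An isomorphism of digraphs carries separate maps on vertices and on arcs. Here tail and
  head are the projections on both sides, so the arc map is forced to be the product of the vertex
  map with itself.\<close>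

lemma graph_iso_iff:
  assumes G: "pair_graph G" and H: "pair_graph H"
  shows "graph_iso G H \<longleftrightarrow> (\<exists>\<phi>. bij_betw \<phi> (pverts G) (pverts H) \<and>
    (\<forall>u\<in>pverts G. \<forall>v\<in>pverts G. (\<phi> u, \<phi> v) \<in> parcs H \<longleftrightarrow> (u, v) \<in> parcs G))"
proof
  interpret G: pair_graph G by (rule G)
  assume "graph_iso G H"
  then obtain f where f: "pre_digraph.digraph_isomorphism (with_proj G) f" and app: "with_proj H = app_iso f (with_proj G)"
    by (auto simp: graph_iso_def digraph_iso_def)
  let ?\<phi> = "iso_verts f"
  have V: "pverts H = ?\<phi> ` pverts G" and A: "parcs H = iso_arcs f ` parcs G"
    and ht: "iso_tail f = fst" "iso_head f = snd"
    using app by (metis app_iso_simps with_proj_simps)+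
  have inj: "inj_on ?\<phi> (pverts G)"
    using f by (simp add: pre_digraph.digraph_isomorphism_def)
  have arc: "iso_arcs f (u, v) = (?\<phi> u, ?\<phi> v)" if "(u, v) \<in> parcs G" for u v
    using f that by (auto simp: pre_digraph.digraph_isomorphism_def ht prod_eq_iff)
  have "(?\<phi> u, ?\<phi> v) \<in> parcs H \<longleftrightarrow> (u, v) \<in> parcs G" if uv: "u \<in> pverts G" "v \<in> pverts G" for u v
  proof
    assume "(?\<phi> u, ?\<phi> v) \<in> parcs H"
    then obtain a b where ab: "(a, b) \<in> parcs G" "(?\<phi> u, ?\<phi> v) = iso_arcs f (a, b)" unfolding A by auto
    then have "a = u" "b = v"
      using arc[OF ab(1)] inj uv G.in_arcsD1 G.in_arcsD2 by (auto dest: inj_onD)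
    then show "(u, v) \<in> parcs G" using ab by simp
  qed (use arc A in force)
  then show "\<exists>\<phi>. bij_betw \<phi> (pverts G) (pverts H) \<and>
    (\<forall>u\<in>pverts G. \<forall>v\<in>pverts G. (\<phi> u, \<phi> v) \<in> parcs H \<longleftrightarrow> (u, v) \<in> parcs G)"
    using inj V by (intro exI[of _ ?\<phi>]) (auto simp: bij_betw_def)
next
  interpret G: pair_graph G by (rule G)
  interpret H: pair_graph H by (rule H)
  assume "\<exists>\<phi>. bij_betw \<phi> (pverts G) (pverts H) \<and>
    (\<forall>u\<in>pverts G. \<forall>v\<in>pverts G. (\<phi> u, \<phi> v) \<in> parcs H \<longleftrightarrow> (u, v) \<in> parcs G)"
  then obtain \<phi> where bij: "bij_betw \<phi> (pverts G) (pverts H)"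
    and arcs: "\<And>u v. u \<in> pverts G \<Longrightarrow> v \<in> pverts G \<Longrightarrow> (\<phi> u, \<phi> v) \<in> parcs H \<longleftrightarrow> (u, v) \<in> parcs G"
    by blast
  let ?f = "\<lparr>iso_verts = \<phi>, iso_arcs = map_prod \<phi> \<phi>, iso_head = snd, iso_tail = fst\<rparr>"
  have inj: "inj_on \<phi> (pverts G)" using bij by (rule bij_betw_imp_inj_on)
  have sub: "parcs G \<subseteq> pverts G \<times> pverts G" using G.in_arcsD1 G.in_arcsD2 by auto
  have "inj_on (map_prod \<phi> \<phi>) (parcs G)"
    using map_prod_inj_on[OF inj inj] sub by (rule inj_on_subset)
  then have "pre_digraph.digraph_isomorphism (with_proj G) ?f"
    using inj G.wf_digraph_axioms by (simp add: pre_digraph.digraph_isomorphism_def)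
  moreover have "parcs H = map_prod \<phi> \<phi> ` parcs G"
  proof (intro equalityI subsetI)
    fix a assume a: "a \<in> parcs H"
    then have "fst a \<in> \<phi> ` pverts G" "snd a \<in> \<phi> ` pverts G"
      using bij H.arc_fst_in_verts H.arc_snd_in_verts by (auto simp: bij_betw_def)
    then obtain u v where "u \<in> pverts G" "v \<in> pverts G" "a = (\<phi> u, \<phi> v)"
      by (auto simp: prod_eq_iff)
    then show "a \<in> map_prod \<phi> \<phi> ` parcs G" using a arcs by force
  qed (use arcs sub in auto)
  then have "with_proj H = app_iso ?f (with_proj G)"
    using bij by (simp add: app_iso_def with_proj_def bij_betw_def)
  ultimately show "graph_iso G H" by (auto simp: graph_iso_def digraph_iso_def)
qed

text \<open>These invariants suffice to recognise, in an isomorphic copy of an extremal graph, the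
  internal clique and the distribution of the pendent vertices.\<close>

lemma graph_isoE:
  assumes "pair_graph G" "pair_graph H" "graph_iso G H"
  obtains \<phi> where "bij_betw \<phi> (internal_verts G) (internal_verts H)"
    "\<forall>u\<in>internal_verts G. deg H (\<phi> u) = deg G u"
    "internal_clique H \<longrightarrow> internal_clique G"
proof -
  interpret G: pair_graph G by fact
  interpret H: pair_graph H by fact
  obtain \<phi> where bij: "bij_betw \<phi> (pverts G) (pverts H)"
    and arcs: "\<And>u v. u \<in> pverts G \<Longrightarrow> v \<in> pverts G \<Longrightarrow> (\<phi> u, \<phi> v) \<in> parcs H \<longleftrightarrow> (u, v) \<in> parcs G"
    using assms graph_iso_iff by metis
  have inj: "inj_on \<phi> (pverts G)" using bij by (rule bij_betw_imp_inj_on)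
  have deg: "deg H (\<phi> u) = deg G u" if u: "u \<in> pverts G" for u
  proof -
    have "{w. (\<phi> u, w) \<in> parcs H} = \<phi> ` {v. (u, v) \<in> parcs G}"
    proof (intro equalityI subsetI)
      fix w assume w: "w \<in> {w. (\<phi> u, w) \<in> parcs H}"
      then have "w \<in> \<phi> ` pverts G" using bij H.in_arcsD2 by (auto simp: bij_betw_def)
      then show "w \<in> \<phi> ` {v. (u, v) \<in> parcs G}" using w arcs u by auto
    qed (use arcs u G.in_arcsD2 in auto)
    moreover have "inj_on \<phi> {v. (u, v) \<in> parcs G}"
      using inj by (rule inj_on_subset) (use G.in_arcsD2 in auto)
    ultimately show ?thesis by (simp add: deg_eq_card card_image)
  qed
  have int: "bij_betw \<phi> (internal_verts G) (internal_verts H)"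
  proof (rule bij_betw_subset[OF bij])
    have "pverts H = \<phi> ` pverts G" using bij by (simp add: bij_betw_def)
    then show "\<phi> ` internal_verts G = internal_verts H" using deg by (auto simp: internal_verts_def)
  qed (auto simp: internal_verts_def)
  show thesis
  proof (rule that)
    show "bij_betw \<phi> (internal_verts G) (internal_verts H)" by (rule int)
    show "\<forall>u\<in>internal_verts G. deg H (\<phi> u) = deg G u"
      using deg by (simp add: internal_verts_def)
    show "internal_clique H \<longrightarrow> internal_clique G"
      unfolding internal_clique_def[of G]
    proof (intro ballI impI)
      fix u v assume H: "internal_clique H" and uv: "u \<in> internal_verts G" "v \<in> internal_verts G" "u \<noteq> v"
      then have V: "u \<in> pverts G" "v \<in> pverts G" by (auto simp: internal_verts_def)
      have "\<phi> u \<noteq> \<phi> v" using uv V inj by (auto dest: inj_onD)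
      moreover have "\<phi> u \<in> internal_verts H" "\<phi> v \<in> internal_verts H"
        using uv int by (auto simp: bij_betw_def)
      ultimately show "(u, v) \<in> parcs G" using H arcs V by (auto simp: internal_clique_def)
    qed
  qed
qed

text \<open>In an internal clique the degree of a vertex exceeds the number of its pendent
  neighbours by one less than the number of internal vertices. Equal degrees therefore mean equally
  many pendent neighbours, and any bijections between these sets extend \<open>\<sigma>\<close> to
  an isomorphism.\<close>

lemma graph_isoI_internal:
  assumes G: "pair_graph G" "pendent_independent G" "internal_clique G"
    and H: "pair_graph H" "pendent_independent H" "internal_clique H"
    and \<sigma>: "bij_betw \<sigma> (internal_verts G) (internal_verts H)"
    and deg: "\<And>i. i \<in> internal_verts G \<Longrightarrow> deg H (\<sigma> i) = deg G i"
  shows "graph_iso G H"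
proof -
  interpret G: pair_graph G by fact
  interpret H: pair_graph H by fact
  let ?I = "internal_verts G" and ?J = "internal_verts H"
  have \<sigma>J: "\<sigma> i \<in> ?J" if "i \<in> ?I" for i using that \<sigma> by (auto simp: bij_betw_def)
  have \<sigma>inj: "\<sigma> i = \<sigma> j \<longleftrightarrow> i = j" if "i \<in> ?I" "j \<in> ?I" for i j
    using that \<sigma> by (auto simp: bij_betw_def dest: inj_onD)
  have "\<exists>h. bij_betw h (hang G i) (hang H (\<sigma> i))" if i: "i \<in> ?I" for i
  proof (rule finite_same_card_bij)
    have "card ?I = card ?J" using \<sigma> by (rule bij_betw_same_card)
    then show "card (hang G i) = card (hang H (\<sigma> i))"
      using deg_internal_clique[OF G(1,3) i] deg_internal_clique[OF H(1,3) \<sigma>J[OF i]] deg[OF i] by simp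
  qed (use finite_verts_parts(3)[OF G(1)] finite_verts_parts(3)[OF H(1)] in auto)
  then obtain h where h: "\<And>i. i \<in> ?I \<Longrightarrow> bij_betw (h i) (hang G i) (hang H (\<sigma> i))" by metis
  have "\<exists>i\<in>?I. v \<in> hang G i" if "v \<in> pendent_verts G" for v
    using hang_partition(1)[OF G(1,2)] that by auto
  \<comment> \<open>\<open>a v\<close> is the internal vertex to which the pendent vertex
    \<open>v\<close> is attached; it selects which of the bijections \<open>h i\<close> applies to
    \<open>v\<close>.\<close>
  then obtain a where a: "\<And>v. v \<in> pendent_verts G \<Longrightarrow> a v \<in> ?I \<and> v \<in> hang G (a v)" by metis
  have aeq: "a v = i" if "v \<in> hang G i" for v i
    using a[of v] that hang_unique[OF G(1,2)] by (auto simp: hang_def)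
  define \<phi> where "\<phi> v = (if v \<in> ?I then \<sigma> v else h (a v) v)" for v
  have \<phi>I: "\<phi> i = \<sigma> i" if "i \<in> ?I" for i using that by (simp add: \<phi>_def)
  have \<phi>h: "\<phi> v = h i v" if "v \<in> hang G i" for v i
    using that aeq pverts_split(2)[of G] by (auto simp: \<phi>_def hang_def)
  have \<phi>hang: "bij_betw \<phi> (hang G i) (hang H (\<sigma> i))" if "i \<in> ?I" for i
    using bij_betw_cong[of "hang G i" \<phi> "h i" "hang H (\<sigma> i)"] \<phi>h h[OF that] by blast
  have bij_internal: "bij_betw \<phi> ?I ?J"
    using bij_betw_cong[of ?I \<phi> \<sigma> ?J] \<phi>I \<sigma> by blast
  have "bij_betw \<phi> (\<Union>i\<in>?I. hang G i) (\<Union>i\<in>?I. hang H (\<sigma> i))"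
  proof (rule bij_betw_UNION_disjoint)
    show "disjoint_family_on (\<lambda>i. hang H (\<sigma> i)) ?I"
      unfolding disjoint_family_on_def using hang_unique[OF H(1,2)] \<sigma>inj by blast
  qed (rule \<phi>hang)
  moreover have "(\<Union>i\<in>?I. hang H (\<sigma> i)) = (\<Union>j\<in>?J. hang H j)"
    using bij_betw_imp_surj_on[OF \<sigma>, symmetric] by simp
  ultimately have bij_pendent: "bij_betw \<phi> (pendent_verts G) (pendent_verts H)"
    using hang_partition(1)[OF G(1,2)] hang_partition(1)[OF H(1,2)] by simp
  have bij: "bij_betw \<phi> (pverts G) (pverts H)"
    using bij_betw_combine[OF bij_internal bij_pendent] pverts_split[of G] pverts_split[of H] by simp
  have IP: "(\<phi> u, \<phi> v) \<in> parcs H \<longleftrightarrow> (u, v) \<in> parcs G" if u: "u \<in> ?I" and v: "v \<in> pendent_verts G" for u v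
  proof -
    have \<phi>v: "\<phi> v \<in> hang H (\<sigma> (a v))" "\<phi> v \<in> pendent_verts H"
      using \<phi>hang a[OF v] bij_pendent v by (auto simp: bij_betw_def)
    have "(\<phi> u, \<phi> v) \<in> parcs H \<longleftrightarrow> \<phi> v \<in> hang H (\<sigma> u)" using \<phi>v \<phi>I[OF u] by (simp add: hang_def)
    also have "\<dots> \<longleftrightarrow> \<sigma> u = \<sigma> (a v)" using \<phi>v hang_unique[OF H(1,2)] by metis
    also have "\<dots> \<longleftrightarrow> u = a v" using \<sigma>inj u a[OF v] by simp
    also have "\<dots> \<longleftrightarrow> v \<in> hang G u" using a[OF v] aeq by metis
    also have "\<dots> \<longleftrightarrow> (u, v) \<in> parcs G" using v by (simp add: hang_def)
    finally show ?thesis .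
  qed
  have arcs: "(\<phi> u, \<phi> v) \<in> parcs H \<longleftrightarrow> (u, v) \<in> parcs G" if "u \<in> pverts G" "v \<in> pverts G" for u v
  proof -
    consider "u \<in> ?I" "v \<in> ?I" | "u \<in> ?I" "v \<in> pendent_verts G" | "u \<in> pendent_verts G" "v \<in> ?I"
      | "u \<in> pendent_verts G" "v \<in> pendent_verts G"
      using \<open>u \<in> pverts G\<close> \<open>v \<in> pverts G\<close> pverts_split(1)[of G] by blast
    then show ?thesis
    proof cases
      case 1
      have "(u, v) \<in> parcs G \<longleftrightarrow> u \<noteq> v"
        using 1 G(3) G.no_loops' unfolding internal_clique_def by blast
      moreover have "(\<sigma> u, \<sigma> v) \<in> parcs H \<longleftrightarrow> \<sigma> u \<noteq> \<sigma> v"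
        using 1 \<sigma>J H(3) H.no_loops' unfolding internal_clique_def by blast
      ultimately show ?thesis using 1 \<sigma>inj \<phi>I by simp
    next
      case 3
      then show ?thesis using IP[OF 3(2,1)] G.arcs_symmetric H.arcs_symmetric by blast
    next
      case 4
      then have "\<phi> u \<in> pendent_verts H" "\<phi> v \<in> pendent_verts H" using bij_pendent by (auto simp: bij_betw_def)
      then show ?thesis using 4 G(2) H(2) by (auto simp: pendent_independent_def)
    qed (rule IP)
  qed
  show ?thesis unfolding graph_iso_iff[OF G(1) H(1)] using bij arcs by blast
qed

section \<open>Structure of the extremal graphs\<close>

lemma deg_star:
  assumes "u < k + 1"
  shows "deg (star k) u = (if u = 0 then k else 1)"
proof -
  have N: "{v \<in> {..<k + 1}. u \<noteq> v \<and> (u = 0 \<or> v = 0)} = (if u = 0 then {1..<k + 1} else {0})"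
    using assms by auto
  show ?thesis
    unfolding star_def deg_simple_graph N using assms by simp
qed

lemma pendent_verts_eq: "pendent_verts G = pverts G - internal_verts G"
  by (auto simp: internal_verts_def pendent_verts_def)

text \<open>For k = 1 both vertices of the single edge are pendent. For k = 0 the isolated centre
  has degree 0 and counts as internal.\<close>

lemma internal_verts_star: "k \<noteq> 1 \<Longrightarrow> internal_verts (star k) = {0}"
  by (auto simp: internal_verts_def pverts_models deg_star split: if_splits)

lemma star_structure:
  assumes "k \<noteq> 1"
  shows "pendent_independent (star k)" "internal_clique (star k)"
  unfolding pendent_independent_def internal_clique_def pendent_verts_eq internal_verts_star[OF assms] pverts_models
  by (auto simp: star_def simple_graph_def)

lemma double_star_structure:
  assumes "2 \<le> a" "2 \<le> b"
  shows "pendent_independent (double_star a b)" "internal_clique (double_star a b)"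
  unfolding pendent_independent_def internal_clique_def pendent_verts_eq internal_verts_double_star[OF assms] pverts_models
  using assms by (auto simp: double_star_def simple_graph_def)

lemma complete_pendent_structure:
  assumes "3 \<le> m"
  shows "pendent_independent (complete_pendent m p)" "internal_clique (complete_pendent m p)"
  unfolding pendent_independent_def internal_clique_def pendent_verts_eq internal_verts_complete_pendent[OF assms] pverts_models
  using assms by (auto simp: complete_pendent_def simple_graph_def)

text \<open>The weight equals sqrt((m - 2)/(m - 1)), and one factor sqrt(m - 1) cancels. This is the
  contribution of the internal edges away from the hub, in the form used in the bound.\<close>

lemma abs_weight_clique:
  assumes "2 \<le> m"
  shows "(m - 1) * (m - 2) / 2 * abs_weight (2 * m - 2) = sqrt (m - 1) * (m - 2) powr (3 / 2) / 2"
proof -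
  have "(2 * m - 2 - 2) / (2 * m - 2) = (2 * (m - 2)) / (2 * (m - 1))" by (simp add: algebra_simps)
  also have "\<dots> = (m - 2) / (m - 1)" by (rule mult_divide_mult_cancel_left) simp
  finally have "abs_weight (2 * m - 2) = sqrt (m - 2) / sqrt (m - 1)"
    by (simp add: abs_weight_def real_sqrt_divide)
  moreover have "(m - 1) / sqrt (m - 1) = sqrt (m - 1)" using assms by (simp add: real_div_sqrt)
  moreover have "(m - 2) powr (3 / 2) = (m - 2) * sqrt (m - 2)"
  proof -
    have "(m - 2) powr (3 / 2) = (m - 2) powr (1 + 1 / 2)" by simp
    also have "\<dots> = (m - 2) * sqrt (m - 2)"
      unfolding powr_add using assms by (simp add: powr_half_sqrt)
    finally show ?thesis .
  qed
  moreover have "(m - 1) * (m - 2) / 2 * (sqrt (m - 2) / sqrt (m - 1))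
      = (m - 1) / sqrt (m - 1) * ((m - 2) * sqrt (m - 2)) / 2" by simp
  ultimately show ?thesis by simp
qed

section \<open>The three cases of the theorem\<close>

context
  fixes G :: "'a pair_pre_digraph" and n p :: nat
  assumes G: "pair_graph G"
    and con: "Digraph_Component.connected (with_proj G)"
    and n: "n = card (pverts G)"
    and p: "p = card (pendent_verts G)"
begin

lemma card_internal: "card (internal_verts G) = n - p" "p \<le> n"
  using card_pverts[OF G] n p by auto

lemma pendent_independent_if_less: "p < n \<Longrightarrow> pendent_independent G"
  using pendent_independent_if_connected[OF G con] card_internal(1) by fastforce

text \<open>A single internal vertex is trivially a clique carrying all pendent vertices. Each of
  the n - 1 edges has degree sum n, so the root covers the whole fraction (n - 2)/n.\<close>

lemma ABS_one_internal:
  assumes "p + 1 = n"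
  shows "graph_iso G (star (n - 1)) \<and> ABS G = (real n - 1) * sqrt ((real n - 2) / real n)"
proof -
  have "card (internal_verts G) = 1" using card_internal(1) assms by simp
  then obtain c where c: "internal_verts G = {c}" by (auto simp: card_1_singleton_iff)
  have ind: "pendent_independent G" using pendent_independent_if_less assms by simp
  have clq: "internal_clique G" by (simp add: internal_clique_def c)
  have hang: "card (hang G c) = p" using sum_card_hang[OF G ind] by (simp add: c p)
  have deg: "deg G c = p" using deg_internal_clique[OF G clq] c hang by simp
  \<comment> \<open>Otherwise the internal vertex \<open>c\<close> would have degree 1.\<close>
  have "n - 1 \<noteq> 1" using deg c assms by (auto simp: internal_verts_def)
  note star = pair_graph_models(1) star_structure[OF this] internal_verts_star[OF this]
  have "graph_iso G (star (n - 1))"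
  proof (rule graph_isoI_internal[OF G ind clq star(1-3), where \<sigma> = "\<lambda>_. 0"])
    show "deg (star (n - 1)) 0 = deg G i" if "i \<in> internal_verts G" for i
      using that assms deg by (auto simp: c deg_star)
  qed (unfold star(4) c, simp add: bij_betw_def)
  moreover have "ABS G = (real n - 1) * sqrt ((real n - 2) / real n)"
  proof -
    have "real n = real p + 1" using assms by simp
    then show ?thesis
      using clique_abs_concentrated[of "{c}" c "\<lambda>i. card (hang G i)"]
      unfolding ABS_clique[OF G ind clq] c by (simp add: hang abs_weight_def)
  qed
  ultimately show ?thesis ..
qed

text \<open>The pendent edges contribute H(x + 2) + H(y + 2) with H(s) = (s - 2) f(s), where x + y =
  n - 2, and the internal edge always has degree sum n. Both x and y are positive, so the extreme
  distribution is 1 and n - 3 rather than 0 and n - 2.\<close>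

lemma ABS_two_internal:
  assumes pn: "p + 2 = n"
  defines "B \<equiv> 1 / sqrt 3 + sqrt ((real n - 2) / real n) + (real n - 3) * sqrt ((real n - 3) / (real n - 1))"
  shows "ABS G \<le> B \<and> (ABS G = B \<longleftrightarrow> graph_iso G (double_star 2 (n - 2)))"
proof -
  interpret pair_graph G by (rule G)
  have card2: "card (internal_verts G) = 2" using card_internal(1) pn by simp
  then obtain a b where ab: "internal_verts G = {a, b}" "a \<noteq> b" by (auto simp: card_2_iff)
  have ind: "pendent_independent G" using pendent_independent_if_less pn by simp
  \<comment> \<open>If the two internal vertices were not adjacent, \<open>a\<close> with its
    pendent neighbours would be closed under adjacency and miss \<open>b\<close>.\<close>
  have "(a, b) \<in> parcs G"
  proof (rule ccontr)
    assume na: "(a, b) \<notin> parcs G"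
    have "insert a (hang G a) = pverts G"
    proof (rule connected_closed_eq[OF G con])
      show "insert a (hang G a) \<subseteq> pverts G"
        using ab by (auto simp: hang_def pendent_verts_def internal_verts_def)
      fix u v assume u: "u \<in> insert a (hang G a)" and uv: "(u, v) \<in> parcs G"
      show "v \<in> insert a (hang G a)"
      proof (cases "u = a")
        case True
        then have "v \<in> pendent_verts G"
          using uv na no_loops' in_arcsD2 pverts_split(1)[of G] ab by auto
        then show ?thesis using True uv by (simp add: hang_def)
      next
        case False
        then have "u \<in> hang G a" using u by simp
        then have "u \<in> pendent_verts G" "(u, a) \<in> parcs G"
          by (auto simp: hang_def intro: arcs_symmetric)
        then have "v = a" using uv by (intro pendent_nbr_unique[OF G])
        then show ?thesis by simp
      qed
    qed simp
    then show False using ab by (auto simp: internal_verts_def hang_def pendent_verts_def)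
  qed
  then have clq: "internal_clique G" using arcs_symmetric by (auto simp: internal_clique_def ab)
  define x where "x = card (hang G a)"
  define y where "y = card (hang G b)"
  have deg: "deg G a = x + 1" "deg G b = y + 1"
    using deg_internal_clique[OF G clq, of a] deg_internal_clique[OF G clq, of b] ab card2
    by (auto simp: x_def y_def)
  have "a \<in> internal_verts G" "b \<in> internal_verts G" using ab by auto
  then have pos: "0 < x" "0 < y" using deg by (auto simp: internal_verts_def)
  have xy: "x + y = n - 2"
    using sum_card_hang[OF G ind] ab pn p by (simp add: x_def y_def)
  have n4: "4 \<le> n" using xy pos pn by linarith
  have rxy: "real x + real y + 2 = real n" using xy n4 by linarith
  let ?H = "\<lambda>s. (s - 2) * abs_weight s"
  have ABS: "ABS G = ?H (real x + 2) + ?H (real y + 2) + abs_weight (real n)"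
    unfolding ABS_clique[OF G ind clq] clique_abs_def
    using ab rxy by (simp add: card2 insert_Diff_if flip: x_def y_def) (simp add: add_ac)
  have B: "B = ?H 3 + ?H (real n - 1) + abs_weight (real n)"
    by (simp add: B_def abs_weight_def real_sqrt_divide)
  have "graph_iso G (double_star 2 (n - 2)) \<longleftrightarrow> x = 1 \<or> y = 1"
  proof
    have n2: "2 \<le> n - 2" using n4 by simp
    note H = pair_graph_models(2) double_star_structure[OF order_refl n2]
      internal_verts_double_star[OF order_refl n2]
    have dH: "deg (double_star 2 (n - 2)) 0 = 2" "deg (double_star 2 (n - 2)) 1 = n - 2"
      using n4 by (simp_all add: deg_double_star)
    {
      assume "graph_iso G (double_star 2 (n - 2))"
      then obtain \<phi> where \<phi>: "bij_betw \<phi> (internal_verts G) (internal_verts (double_star 2 (n - 2)))"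
        "\<forall>u\<in>internal_verts G. deg (double_star 2 (n - 2)) (\<phi> u) = deg G u"
        using graph_isoE[OF G H(1)] by blast
      have "0 \<in> \<phi> ` internal_verts G"
        unfolding bij_betw_imp_surj_on[OF \<phi>(1)] H(4) by simp
      then obtain u where u: "u \<in> internal_verts G" "0 = \<phi> u" by (rule imageE)
      have "deg G u = 2" using bspec[OF \<phi>(2) u(1)] dH(1) u(2) by metis
      then show "x = 1 \<or> y = 1" using u(1) ab deg by auto
    }
    assume *: "x = 1 \<or> y = 1"
    \<comment> \<open>The internal vertex with a single pendent neighbour goes to 0, the one of
      degree 2; if both have one, \<open>a\<close> goes there.\<close>
    define \<sigma> where "\<sigma> i = (if (i = a) = (x = 1) then 0 else 1::nat)" for i
    show "graph_iso G (double_star 2 (n - 2))"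
    proof (rule graph_isoI_internal[OF G ind clq H(1-3), where \<sigma> = \<sigma>])
      show "bij_betw \<sigma> (internal_verts G) (internal_verts (double_star 2 (n - 2)))"
        unfolding H(4) ab(1) bij_betw_def \<sigma>_def using ab(2) by auto
      show "deg (double_star 2 (n - 2)) (\<sigma> i) = deg G i" if "i \<in> internal_verts G" for i
        using that dH ab deg xy * by (auto simp: \<sigma>_def)
    qed
  qed
  moreover have "ABS G = B" if "x = 1 \<or> y = 1"
    using that
  proof
    assume "x = 1"
    then have "real n = real y + 3" using rxy by simp
    then show ?thesis using \<open>x = 1\<close> unfolding ABS B by (simp add: add.commute)
  next
    assume "y = 1"
    then have "real n = real x + 3" using rxy by simp
    then show ?thesis using \<open>y = 1\<close> unfolding ABS B by (simp add: add.commute)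
  qed
  moreover have "ABS G < B" if "\<not> (x = 1 \<or> y = 1)"
  proof -
    \<comment> \<open>Supermodularity is applied at base point 3, which stands for one pendent
      neighbour, with the excesses x - 1 and y - 1 as increments.\<close>
    have "0 < real x - 1" "0 < real y - 1" using that pos by auto
    from scaled_abs_weight_supermodular[OF _ this, of 3]
    have "?H (real x + 2) + ?H (real y + 2) < ?H 3 + ?H (real x + real y + 1)" by (simp add: algebra_simps)
    moreover have "real x + real y + 1 = real n - 1" using rxy by simp
    ultimately have "?H (real x + 2) + ?H (real y + 2) < ?H 3 + ?H (real n - 1)" by (simp only:)
    then show ?thesis unfolding ABS B by linarith
  qed
  ultimately show ?thesis by fastforce
qed

text \<open>The bound is the index of the extremal graph: its hub has degree n - 1 and its other
  internal vertices n - p - 1, so the n - p - 1 edges joining them have degree sum 2n - p - 2. The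
  fraction (2n - 2p - 3)/(2n - 2p - 1) of the English statement agrees with the resulting (2n - p -
  4)/(2n - p - 2) only for p = 1. Equality requires both comparisons to be tight: an internal clique
  and a concentrated distribution.\<close>

lemma ABS_many_internal:
  assumes pn: "p + 3 \<le> n"
  defines "B \<equiv> real p * sqrt ((real n - 2) / real n)
     + (real n - real p - 1) * sqrt ((2 * real n - real p - 4) / (2 * real n - real p - 2))
     + sqrt (real n - real p - 1) * (real n - real p - 2) powr (3 / 2) / 2"
  shows "ABS G \<le> B \<and> (ABS G = B \<longleftrightarrow> graph_iso G (complete_pendent (n - p) p))"
proof -
  let ?I = "internal_verts G" and ?h = "\<lambda>i. card (hang G i)"
  have ind: "pendent_independent G" using pendent_independent_if_less pn by simp
  have card3: "3 \<le> card ?I" using card_internal pn by simp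
  have m3: "3 \<le> n - p" using pn by simp
  have fin: "finite ?I" using finite_verts_parts[OF G] by simp
  have m: "real (card ?I) = real n - real p" using card_internal by (simp add: of_nat_diff)
  have hp: "sum ?h ?I = p" using sum_card_hang[OF G ind] p by simp
  have B: "B = real p * abs_weight (real p + real (card ?I))
      + (real (card ?I) - 1) * abs_weight (real p + 2 * real (card ?I) - 2)
      + (real (card ?I) - 1) * (real (card ?I) - 2) / 2 * abs_weight (2 * real (card ?I) - 2)"
    using card3 pn by (subst abs_weight_clique) (simp_all add: B_def abs_weight_def m algebra_simps)
  have max: "clique_abs ?I ?h \<le> B" "clique_abs ?I ?h = B \<longleftrightarrow> (\<exists>i\<in>?I. \<forall>j\<in>?I - {i}. ?h j = 0)"
    using clique_abs_max[OF fin card3, of ?h] unfolding hp B by blast+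
  have le: "ABS G \<le> clique_abs ?I ?h" "ABS G = clique_abs ?I ?h \<longleftrightarrow> internal_clique G"
    using ABS_clique[OF G ind] ABS_less_clique[OF G ind card3] by fastforce+
  have "graph_iso G (complete_pendent (n - p) p)
      \<longleftrightarrow> internal_clique G \<and> (\<exists>i\<in>?I. \<forall>j\<in>?I - {i}. ?h j = 0)"
  proof
    note H = pair_graph_models(3) complete_pendent_structure[OF m3, of p]
      internal_verts_complete_pendent[OF m3, of p]
    have dH: "deg (complete_pendent (n - p) p) u = (if u = 0 then n - 1 else n - p - 1)" if "u < n - p" for u
      using that m3 by (simp add: deg_complete_pendent)
    {
      assume "graph_iso G (complete_pendent (n - p) p)"
      then obtain \<phi> where \<phi>: "bij_betw \<phi> ?I (internal_verts (complete_pendent (n - p) p))"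
        "\<forall>u\<in>?I. deg (complete_pendent (n - p) p) (\<phi> u) = deg G u"
        and "internal_clique (complete_pendent (n - p) p) \<longrightarrow> internal_clique G"
        using graph_isoE[OF G H(1)] by blast
      then have clq: "internal_clique G" using H(3) by blast
      note \<phi> = \<phi>[unfolded H(4)]
      have "0 \<in> \<phi> ` ?I" using \<phi>(1) m3 by (auto simp: bij_betw_def)
      then obtain i where i: "i \<in> ?I" "\<phi> i = 0" by auto
      have "?h j = 0" if j: "j \<in> ?I - {i}" for j
      proof -
        have "\<phi> j < n - p" using \<phi>(1) j by (auto simp: bij_betw_def)
        \<comment> \<open>Vertex 0 is already the image of \<open>i\<close>. Every other internal
          vertex has degree n - p - 1, which the clique alone accounts for, so it has no pendent
          neighbours.\<close>
        moreover have "\<phi> j \<noteq> 0"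
          using inj_onD[OF bij_betw_imp_inj_on[OF \<phi>(1)], of j i] i j by auto
        ultimately have "deg G j = n - p - 1" using dH[of "\<phi> j"] \<phi>(2) j by simp
        then show ?thesis using deg_internal_clique[OF G clq, of j] j m3 by (simp add: card_internal(1))
      qed
      then show "internal_clique G \<and> (\<exists>i\<in>?I. \<forall>j\<in>?I - {i}. ?h j = 0)" using clq i(1) by blast
    }
    assume "internal_clique G \<and> (\<exists>i\<in>?I. \<forall>j\<in>?I - {i}. ?h j = 0)"
    then obtain i where clq: "internal_clique G" and i: "i \<in> ?I" "\<And>j. j \<in> ?I - {i} \<Longrightarrow> ?h j = 0"
      by blast
    have hi: "?h i = p" using hp fin i by (simp add: sum.remove)
    have "card (?I - {i}) = card {1..<n - p}"
      using i(1) fin card_internal(1) by simp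
    then obtain f where f: "bij_betw f (?I - {i}) {1..<n - p}"
      using fin by (metis finite_Diff finite_atLeastLessThan finite_same_card_bij)
    define \<sigma> where "\<sigma> j = (if j = i then 0 else f j)" for j
    show "graph_iso G (complete_pendent (n - p) p)"
    proof (rule graph_isoI_internal[OF G ind clq H(1-3), where \<sigma> = \<sigma>])
      have "bij_betw \<sigma> (?I - {i}) {1..<n - p}"
        using f by (subst bij_betw_cong[where g = f]) (auto simp: \<sigma>_def)
      moreover have "bij_betw \<sigma> {i} {0}" by (simp add: \<sigma>_def bij_betw_def)
      ultimately have "bij_betw \<sigma> ({i} \<union> (?I - {i})) ({0} \<union> {1..<n - p})"
        by (intro bij_betw_combine) auto
      moreover have "{i} \<union> (?I - {i}) = ?I" "{0} \<union> {1..<n - p} = {..<n - p}" using i(1) m3 by auto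
      ultimately show bij: "bij_betw \<sigma> ?I (internal_verts (complete_pendent (n - p) p))"
        unfolding H(4) by simp
      show "deg (complete_pendent (n - p) p) (\<sigma> j) = deg G j" if j: "j \<in> ?I" for j
      proof -
        have \<sigma>less: "\<sigma> j < n - p" using bij j unfolding H(4) by (auto simp: bij_betw_def)
        have "f j \<noteq> 0" if "j \<noteq> i"
        proof -
          have "f j \<in> {1..<n - p}" using bij_betwE[OF f] j that by blast
          then show ?thesis by simp
        qed
        then have \<sigma>0: "\<sigma> j = 0 \<longleftrightarrow> j = i" by (simp add: \<sigma>_def)
        have "deg G j + 1 = ?h j + (n - p)"
          using deg_internal_clique[OF G clq j] card_internal(1) by simp
        then show ?thesis using \<sigma>less \<sigma>0 hi i(2)[of j] j dH[of "\<sigma> j"] m3 by auto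
      qed
    qed
  qed
  then show ?thesis using max le by linarith
qed

end

theorem theorem5:
  fixes G :: "'a pair_pre_digraph" and n p :: nat
  assumes "pair_graph G"
    and "Digraph_Component.connected (with_proj G)"
    and "n = card (pverts G)"
    and "p = card (pendent_verts G)"
  shows
    "(p + 1 = n \<longrightarrow>
        graph_iso G (star (n - 1)) \<and>
        ABS G = (real n - 1) * sqrt ((real n - 2) / real n)) \<and>
     (p + 2 = n \<longrightarrow>
        (let B = 1 / sqrt 3 + sqrt ((real n - 2) / real n)
               + (real n - 3) * sqrt ((real n - 3) / (real n - 1))
         in ABS G \<le> B \<and> (ABS G = B \<longleftrightarrow> graph_iso G (double_star 2 (n - 2))))) \<and>
     (p + 3 \<le> n \<longrightarrow>
        (let B = real p * sqrt ((real n - 2) / real n)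
               + (real n - real p - 1) * sqrt ((2 * real n - real p - 4) / (2 * real n - real p - 2))
               + sqrt (real n - real p - 1) * (real n - real p - 2) powr (3 / 2) / 2
         in ABS G \<le> B \<and> (ABS G = B \<longleftrightarrow> graph_iso G (complete_pendent (n - p) p))))"
  unfolding Let_def
  using ABS_one_internal[OF assms] ABS_two_internal[OF assms] ABS_many_internal[OF assms]
  by blast

end
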